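(* Let $p\ge1$ be an integer and $\gamma_D>0$. For $\gamma>0$, $\kappa\in(0,1)$ and $(u,q)\in\mathbb P_p\times\mathbb P_p$ (real univariate polynomials of degree at most $p$) set $$a_{\kappa,\gamma}(u,q):=\int_{-1}^0(u')^2+\int_0^\kappa(q')^2-2q'(\kappa)q(\kappa)+\gamma_Dq(\kappa)^2+\gamma\sum_{k=1}^p\frac{(q^{(k)}(0)-u^{(k)}(0))^2}{(k!)^2},$$ $$a_{0,\gamma}(u,q):=\int_{-1}^0(u')^2-2q'(0)q(0)+\gamma_Dq(0)^2+\gamma\sum_{k=1}^p\frac{(q^{(k)}(0)-u^{(k)}(0))^2}{(k!)^2},$$ and $\gamma_*(\kappa):=\inf\{\gamma>0: a_{\kappa,\gamma}\succeq0\}\in[0,\infty]$ with $\inf\varnothing:=\infty$. (i) If $\gamma_D>p^2$, then $a_{0,\gamma}\succeq0$ on $\mathbb P_p\times\mathbb P_p$ if and only if $\gamma\ge\dfrac1{\gamma_D-p^2}$. If $\gamma_D\le p^2$, then $a_{0,\gamma}$ is indefinite for every $\gamma>0$. (ii) For every $\gamma>0$ with $\gamma(\gamma_D-p^2)<1$ there is $\kappa_0>0$ such that $a_{\kappa,\gamma}$ is indefinite for all $\kappa\in(0,\kappa_0)$. In particular $$\sup_{\kappa\in(0,1)}\gamma_*(\kappa)\ge\frac1{\gamma_D-p^2}\ \text{ if }\gamma_D>p^2,\qquad \sup_{\kappa\in(0,1)}\gamma_*(\kappa)=\infty\ \text{ if }\gamma_D\le p^2.$$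
   Context: $a\succeq0$ means the quadratic form $a$ is positive semidefinite on $\mathbb P_p\times\mathbb P_p$, i.e. $a(u,q)\ge0$ for all $(u,q)$; "indefinite" means it takes both positive and negative values. *)

theory Defs
  imports "HOL-Analysis.Analysis" "HOL-Computational_Algebra.Polynomial"
begin

definition polys_upto :: "nat \<Rightarrow> real poly set" where
  "polys_upto p = {q. degree q \<le> p}"

definition jump_penalty :: "nat \<Rightarrow> real poly \<Rightarrow> real poly \<Rightarrow> real" where
  "jump_penalty p u q =
     (\<Sum>k=1..p. (poly ((pderiv ^^ k) q) 0 - poly ((pderiv ^^ k) u) 0)\<^sup>2 / (fact k)\<^sup>2)"

definition cut_form :: "nat \<Rightarrow> real \<Rightarrow> real \<Rightarrow> real \<Rightarrow> real poly \<Rightarrow> real poly \<Rightarrow> real" where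
  "cut_form p \<gamma>D \<kappa> \<gamma> u q =
     integral {-1..0} (\<lambda>x. (poly (pderiv u) x)\<^sup>2)
     + integral {0..\<kappa>} (\<lambda>x. (poly (pderiv q) x)\<^sup>2)
     - 2 * poly (pderiv q) \<kappa> * poly q \<kappa>
     + \<gamma>D * (poly q \<kappa>)\<^sup>2
     + \<gamma> * jump_penalty p u q"

definition cut_form_zero :: "nat \<Rightarrow> real \<Rightarrow> real \<Rightarrow> real poly \<Rightarrow> real poly \<Rightarrow> real" where
  "cut_form_zero p \<gamma>D \<gamma> u q =
     integral {-1..0} (\<lambda>x. (poly (pderiv u) x)\<^sup>2)
     - 2 * poly (pderiv q) 0 * poly q 0
     + \<gamma>D * (poly q 0)\<^sup>2
     + \<gamma> * jump_penalty p u q"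

definition form_psd :: "nat \<Rightarrow> (real poly \<Rightarrow> real poly \<Rightarrow> real) \<Rightarrow> bool" where
  "form_psd p a \<longleftrightarrow> (\<forall>u\<in>polys_upto p. \<forall>q\<in>polys_upto p. 0 \<le> a u q)"

definition form_indefinite :: "nat \<Rightarrow> (real poly \<Rightarrow> real poly \<Rightarrow> real) \<Rightarrow> bool" where
  "form_indefinite p a \<longleftrightarrow>
     (\<exists>u\<in>polys_upto p. \<exists>q\<in>polys_upto p. a u q > 0) \<and>
     (\<exists>u\<in>polys_upto p. \<exists>q\<in>polys_upto p. a u q < 0)"

(* The infimum is taken in the extended reals, where Inf {} is infinity. *)
definition gamma_star :: "nat \<Rightarrow> real \<Rightarrow> real \<Rightarrow> ereal" where
  "gamma_star p \<gamma>D \<kappa> = Inf (ereal ` {\<gamma>. \<gamma> > 0 \<and> form_psd p (cut_form p \<gamma>D \<kappa> \<gamma>)})"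

end

theory Submission
  imports Defs
begin

text \<open>
  Everything rests on the sharp endpoint inequality
  \<open>w(0)\<^sup>2 \<le> p\<^sup>2 \<integral> w\<^sup>2\<close> over \<open>[-1, 0]\<close> for polynomials \<open>w\<close> of degree less than \<open>p\<close>
  (\<open>endpoint_value_bound\<close>). Evaluation at \<open>0\<close> is represented in \<open>L\<^sup>2(-1, 0)\<close> by a
  kernel of degree less than \<open>p\<close>, and \<open>p\<^sup>2\<close> is the value of that kernel at \<open>0\<close>. The kernel
  comes from a Rodrigues formula: it is \<open>D\<^sup>p[x\<^bsup>p-1\<^esup> (1 + x)\<^sup>p] / (p - 1)!\<close>. Integrating by parts
  \<open>p\<close> times against a polynomial of degree less than \<open>p\<close> leaves only one boundary term, because
  \<open>x\<^bsup>p-1\<^esup> (1 + x)\<^sup>p\<close> vanishes to order \<open>p\<close> at \<open>-1\<close> and to order \<open>p - 1\<close> at \<open>0\<close>.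

  In the limit form, write \<open>s = u'(0)\<close>, \<open>c = q(0)\<close> and \<open>q'(0) = s + e\<close>. The endpoint inequality
  and the first summand of the penalty give
  \<open>a\<^sub>0 \<ge> s\<^sup>2/p\<^sup>2 - 2 (s + e) c + \<gamma>D c\<^sup>2 + \<gamma> e\<^sup>2
      = (s/p - p c)\<^sup>2 + \<gamma> (e - c/\<gamma>)\<^sup>2 + (\<gamma>D - p\<^sup>2 - 1/\<gamma>) c\<^sup>2\<close>,
  which settles semidefiniteness for \<open>\<gamma> (\<gamma>D - p\<^sup>2) \<ge> 1\<close>. Conversely the bound is attained: take
  \<open>u'\<close> to be the kernel, \<open>c = 1\<close>, \<open>e = 1/\<gamma>\<close>, and let the higher derivatives of \<open>q\<close> and \<open>u\<close> at
  \<open>0\<close> agree. The value of the form is then exactly \<open>\<gamma>D - p\<^sup>2 - 1/\<gamma>\<close>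
  (\<open>cut_form_zero_witness\<close>).

  For a fixed pair \<open>(u, q)\<close> the form depends continuously on the length \<open>\<kappa>\<close> of the cut cell, so
  a negative value at \<open>\<kappa> = 0\<close> persists for small \<open>\<kappa> > 0\<close>. Since the form increases with
  \<open>\<gamma>\<close>, this bounds \<open>gamma_star\<close> from below by \<open>\<gamma>\<close> for such \<open>\<kappa>\<close>. Every \<open>\<gamma>\<close> with
  \<open>\<gamma> (\<gamma>D - p\<^sup>2) < 1\<close> can be used here, and these \<open>\<gamma>\<close> come arbitrarily close to
  \<open>1 / (\<gamma>D - p\<^sup>2)\<close> if \<open>\<gamma>D > p\<^sup>2\<close> and are unbounded otherwise.
\<close>

section \<open>Calculus of polynomials\<close>

lemma poly_higher_pderiv_0:
  fixes f :: "real poly"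
  shows "poly ((pderiv ^^ k) f) 0 = fact k * coeff f k"
  by (simp add: poly_0_coeff_0 coeff_higher_pderiv pochhammer_fact)

lemma poly_integrable_on [simp]:
  fixes f :: "real poly"
  shows "poly f integrable_on {a..b}"
  by (intro integrable_continuous_real continuous_intros)

lemma integral_pderiv:
  fixes f :: "real poly"
  assumes "a \<le> b"
  shows "integral {a..b} (poly (pderiv f)) = poly f b - poly f a"
proof -
  have "(poly (pderiv f) has_integral (poly f b - poly f a)) {a..b}"
    by (rule fundamental_theorem_of_calculus[OF assms])
       (auto simp flip: has_real_derivative_iff_has_vector_derivative
             intro: DERIV_subset poly_DERIV)
  then show ?thesis
    by (rule integral_unique)
qed

lemma integral_poly_by_parts:
  fixes f g :: "real poly"
  assumes "a \<le> b"
  shows "integral {a..b} (poly (pderiv f * g)) =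
           poly (f * g) b - poly (f * g) a - integral {a..b} (poly (f * pderiv g))"
proof -
  have "poly (pderiv (f * g)) = (\<lambda>x. poly (f * pderiv g) x + poly (pderiv f * g) x)"
    by (simp add: fun_eq_iff pderiv_mult algebra_simps)
  then have "integral {a..b} (poly (pderiv (f * g))) =
      integral {a..b} (poly (f * pderiv g)) + integral {a..b} (poly (pderiv f * g))"
    by (simp only: integral_add[OF poly_integrable_on poly_integrable_on])
  then show ?thesis
    using integral_pderiv[OF assms, of "f * g"] by simp
qed

lemma linear_power_dvd_pderiv:
  fixes f :: "real poly"
  assumes "[:- a, 1:] ^ Suc n dvd f"
  shows "[:- a, 1:] ^ n dvd pderiv f"
proof -
  obtain h where "f = [:- a, 1:] ^ Suc n * h"
    using assms by (rule dvdE)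
  then have "pderiv f = [:- a, 1:] ^ Suc n * pderiv h
      + h * (smult (of_nat (Suc n)) ([:- a, 1:] ^ n) * pderiv [:- a, 1:])"
    by (simp only: pderiv_mult pderiv_power_Suc)
  moreover have "[:- a, 1:] ^ n dvd [:- a, 1:] ^ Suc n * pderiv h"
    by (rule dvd_mult2[OF le_imp_power_dvd]) simp
  moreover have "[:- a, 1:] ^ n dvd
      h * (smult (of_nat (Suc n)) ([:- a, 1:] ^ n) * pderiv [:- a, 1:])"
    by (rule dvd_mult[OF dvd_mult2[OF dvd_smult]]) simp
  ultimately show ?thesis
    by simp
qed

lemma poly_higher_pderiv_at_multiple_root:
  fixes f :: "real poly"
  assumes "[:- a, 1:] ^ n dvd f" and "k < n"
  shows "poly ((pderiv ^^ k) f) a = 0"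
proof -
  have "[:- a, 1:] ^ (n - k) dvd (pderiv ^^ k) f"
    using assms(2)
  proof (induction k)
    case 0
    show ?case
      using assms(1) by simp
  next
    case (Suc k)
    then have "[:- a, 1:] ^ Suc (n - Suc k) dvd (pderiv ^^ k) f"
      by (simp add: Suc_diff_Suc)
    then show ?case
      using linear_power_dvd_pderiv by simp
  qed
  moreover have "[:- a, 1:] dvd [:- a, 1:] ^ (n - k)"
    using assms(2) by (simp add: dvd_power)
  ultimately have "[:- a, 1:] dvd (pderiv ^^ k) f"
    using dvd_trans by blast
  then show ?thesis
    by (simp add: poly_eq_0_iff_dvd)
qed

text \<open>
  Each integration by parts lowers the degree of \<open>v\<close>, so \<open>n + 1\<close> of them annihilate the integral.
  All boundary terms vanish except the first one at the right endpoint, where \<open>f\<close> is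
  only required to vanish to order \<open>n\<close>.
\<close>

lemma integral_higher_pderiv_mult:
  fixes f v :: "real poly"
  assumes "a \<le> b"
    and "\<And>k. k \<le> n \<Longrightarrow> poly ((pderiv ^^ k) f) a = 0"
    and "\<And>k. k < n \<Longrightarrow> poly ((pderiv ^^ k) f) b = 0"
    and "degree v \<le> n"
  shows "integral {a..b} (poly ((pderiv ^^ Suc n) f * v)) = poly ((pderiv ^^ n) f * v) b"
  using assms(2-)
proof (induction n arbitrary: v)
  case 0
  then have "pderiv v = 0"
    by (simp add: pderiv_eq_0_iff)
  moreover have "poly (0 :: real poly) = (\<lambda>_. 0)"
    by (simp add: fun_eq_iff)
  moreover have "poly (f * v) a = 0"
    using 0 by simp
  ultimately show ?case
    using integral_poly_by_parts[OF assms(1), of f v] by (simp del: poly_mult)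
next
  case (Suc n)
  have "integral {a..b} (poly ((pderiv ^^ Suc n) f * pderiv v)) =
      poly ((pderiv ^^ n) f * pderiv v) b"
    using Suc.prems by (intro Suc.IH) (auto simp: degree_pderiv)
  also have "\<dots> = 0"
    using Suc.prems(2)[of n] by simp
  finally have "integral {a..b} (poly ((pderiv ^^ Suc n) f * pderiv v)) = 0" .
  moreover have "poly ((pderiv ^^ Suc n) f * v) a = 0"
    using Suc.prems(1)[of "Suc n"] by simp
  ultimately show ?case
    using integral_poly_by_parts[OF assms(1), of "(pderiv ^^ Suc n) f" v]
    by (simp del: poly_mult)
qed

section \<open>The reproducing kernel of the endpoint\<close>

text \<open>
  The derivative of this polynomial is the reproducing kernel. It is a combination of the shifted
  Legendre polynomials of degrees \<open>p\<close> and \<open>p - 1\<close>, normalised to be \<open>0\<close> at \<open>-1\<close> and \<open>1\<close> at \<open>0\<close>.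
  The primitive, rather than the kernel, is defined because the test function \<open>u\<close> enters the
  forms through \<open>u'\<close>.
\<close>

definition kernel_primitive :: "nat \<Rightarrow> real poly" where
  "kernel_primitive p =
     smult (1 / fact (p - 1)) ((pderiv ^^ (p - 1)) (monom 1 (p - 1) * [:1, 1:] ^ p))"

lemma degree_kernel_primitive: "degree (kernel_primitive p) \<le> p"
proof -
  have "degree (monom (1::real) (p - 1) * [:1, 1:] ^ p) \<le> (p - 1) + p"
    by (intro order.trans[OF degree_mult_le] add_mono)
       (simp_all add: degree_monom_le degree_power_eq)
  then show ?thesis
    by (simp add: kernel_primitive_def degree_higher_pderiv)
qed

lemma kernel_at_0:
  assumes "p \<ge> 1"
  shows "poly (pderiv (kernel_primitive p)) 0 = (real p)\<^sup>2"
proof -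
  obtain n where p: "p = Suc n"
    using assms by (cases p) auto
  let ?g = "monom (1::real) n * [:1, 1:] ^ p"
  have "pderiv (kernel_primitive p) = smult (1 / fact n) ((pderiv ^^ p) ?g)"
    by (simp add: kernel_primitive_def pderiv_smult p)
  then have "poly (pderiv (kernel_primitive p)) 0 = fact p * coeff ?g p / fact n"
    by (simp add: poly_higher_pderiv_0)
  also have "coeff ?g p = real p"
    using assms coeff_linear_poly_power[of 1 p 1 "1::real"]
    by (simp add: coeff_monom_mult p del: power_Suc)
  also have "fact p * real p / fact n = (real p)\<^sup>2"
    by (simp add: p power2_eq_square)
  finally show ?thesis .
qed

lemma kernel_reproduces_endpoint_value:
  fixes v :: "real poly"
  assumes "degree v < p"
  shows "integral {-1..0} (\<lambda>x. poly (pderiv (kernel_primitive p)) x * poly v x) = poly v 0"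
proof -
  obtain n where p: "p = Suc n"
    using assms by (cases p) auto
  let ?g = "monom (1::real) n * [:1, 1:] ^ Suc n"
  have "integral {-1..0} (poly ((pderiv ^^ Suc n) ?g * v)) = poly ((pderiv ^^ n) ?g * v) 0"
  proof (rule integral_higher_pderiv_mult)
    show "poly ((pderiv ^^ k) ?g) (-1) = 0" if "k \<le> n" for k
      using that by (intro poly_higher_pderiv_at_multiple_root[where n = "Suc n"]) auto
    show "poly ((pderiv ^^ k) ?g) 0 = 0" if "k < n" for k
      using that by (simp add: poly_higher_pderiv_0 coeff_monom_mult del: power_Suc)
  qed (use assms p in auto)
  also have "\<dots> = fact n * poly v 0"
    by (simp add: poly_higher_pderiv_0 coeff_monom_mult coeff_0_power del: power_Suc)
  finally have "integral {-1..0} (poly ((pderiv ^^ Suc n) ?g * v)) = fact n * poly v 0" .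
  moreover have "pderiv (kernel_primitive p) = smult (1 / fact n) ((pderiv ^^ Suc n) ?g)"
    by (simp add: kernel_primitive_def pderiv_smult p)
  then have "(\<lambda>x. poly (pderiv (kernel_primitive p)) x * poly v x) =
      (\<lambda>x. 1 / fact n * poly ((pderiv ^^ Suc n) ?g * v) x)"
    by (simp only: poly_mult poly_smult mult.assoc)
  ultimately show ?thesis
    by (simp only: integral_mult_right) simp
qed

lemma kernel_norm:
  assumes "p \<ge> 1"
  shows "integral {-1..0} (\<lambda>x. (poly (pderiv (kernel_primitive p)) x)\<^sup>2) = (real p)\<^sup>2"
proof -
  have "degree (pderiv (kernel_primitive p)) < p"
    using degree_kernel_primitive[of p] assms by (simp add: degree_pderiv)
  then show ?thesis
    using kernel_reproduces_endpoint_value kernel_at_0[OF assms]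
    by (simp add: power2_eq_square)
qed

text \<open>
  This is the Cauchy-Schwarz inequality between \<open>v\<close> and the kernel, obtained from the component of
  \<open>v\<close> orthogonal to the kernel. The kernel itself is an equality case, so the constant is sharp.
\<close>

lemma endpoint_value_bound:
  fixes v :: "real poly"
  assumes "degree v < p"
  shows "(poly v 0)\<^sup>2 / (real p)\<^sup>2 \<le> integral {-1..0} (\<lambda>x. (poly v x)\<^sup>2)"
proof -
  define w where "w = pderiv (kernel_primitive p)"
  define t where "t = poly v 0 / (real p)\<^sup>2"
  have p: "p \<ge> 1"
    using assms by simp
  have cont: "(\<lambda>x. f x) integrable_on {-1..0}" if "continuous_on {-1..0} f" for f :: "real \<Rightarrow> real"
    using that by (rule integrable_continuous_real)
  have expand: "(\<lambda>x. (poly (v - smult t w) x)\<^sup>2) =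
      (\<lambda>x. (poly v x)\<^sup>2 - 2 * t * (poly w x * poly v x) + t\<^sup>2 * (poly w x)\<^sup>2)"
    by (simp add: fun_eq_iff power2_eq_square algebra_simps)
  have "0 \<le> integral {-1..0} (\<lambda>x. (poly (v - smult t w) x)\<^sup>2)"
    by (intro integral_nonneg cont continuous_intros) auto
  also have "\<dots> = integral {-1..0} (\<lambda>x. (poly v x)\<^sup>2)
      - 2 * t * integral {-1..0} (\<lambda>x. poly w x * poly v x)
      + t\<^sup>2 * integral {-1..0} (\<lambda>x. (poly w x)\<^sup>2)"
    unfolding expand
    by (subst integral_add integral_diff; (intro cont continuous_intros)?)+ simp
  also have "\<dots> = integral {-1..0} (\<lambda>x. (poly v x)\<^sup>2) - 2 * t * poly v 0 + t\<^sup>2 * (real p)\<^sup>2"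
    using kernel_reproduces_endpoint_value[OF assms] kernel_norm[OF p] by (simp add: w_def)
  also have "\<dots> = integral {-1..0} (\<lambda>x. (poly v x)\<^sup>2) - (poly v 0)\<^sup>2 / (real p)\<^sup>2"
    using p by (simp add: t_def power2_eq_square)
  finally show ?thesis
    by simp
qed

section \<open>The limit form\<close>

lemma jump_penalty_eq_sum_coeff:
  "jump_penalty p u q = (\<Sum>k=1..p. (coeff q k - coeff u k)\<^sup>2)"
  unfolding jump_penalty_def
  by (intro sum.cong refl)
     (simp add: poly_higher_pderiv_0 flip: right_diff_distrib power_divide)

lemma jump_penalty_nonneg: "jump_penalty p u q \<ge> 0"
  unfolding jump_penalty_eq_sum_coeff by (intro sum_nonneg) simp

lemma first_jump_le_jump_penalty:
  assumes "p \<ge> 1"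
  shows "(poly (pderiv q) 0 - poly (pderiv u) 0)\<^sup>2 \<le> jump_penalty p u q"
proof -
  have "(coeff q 1 - coeff u 1)\<^sup>2 \<le> jump_penalty p u q"
    unfolding jump_penalty_eq_sum_coeff using assms
    by (intro member_le_sum[of 1 "{1..p}" "\<lambda>k. (coeff q k - coeff u k)\<^sup>2"]) auto
  then show ?thesis
    by (simp add: poly_0_coeff_0 coeff_pderiv)
qed

lemma cut_form_zero_nonneg:
  assumes "p \<ge> 1" and "\<gamma> > 0" and "\<gamma> * (\<gamma>D - (real p)\<^sup>2) \<ge> 1" and "degree u \<le> p"
  shows "0 \<le> cut_form_zero p \<gamma>D \<gamma> u q"
proof -
  define s c e where "s = poly (pderiv u) 0" and "c = poly q 0"
    and "e = poly (pderiv q) 0 - poly (pderiv u) 0"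
  have "s\<^sup>2 / (real p)\<^sup>2 \<le> integral {-1..0} (\<lambda>x. (poly (pderiv u) x)\<^sup>2)"
    unfolding s_def using assms by (intro endpoint_value_bound) (simp add: degree_pderiv)
  moreover have "\<gamma> * e\<^sup>2 \<le> \<gamma> * jump_penalty p u q"
    unfolding e_def using assms by (intro mult_left_mono first_jump_le_jump_penalty) auto
  moreover have "s\<^sup>2 / (real p)\<^sup>2 - 2 * (s + e) * c + \<gamma>D * c\<^sup>2 + \<gamma> * e\<^sup>2 =
      (s / real p - real p * c)\<^sup>2 + \<gamma> * (e - c / \<gamma>)\<^sup>2 + (\<gamma>D - (real p)\<^sup>2 - 1 / \<gamma>) * c\<^sup>2"
    using assms(1,2) by (simp add: field_simps power2_eq_square)
  moreover have "0 \<le> \<gamma>D - (real p)\<^sup>2 - 1 / \<gamma>"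
    using assms(2,3) by (simp add: field_simps)
  then have "0 \<le> (s / real p - real p * c)\<^sup>2 + \<gamma> * (e - c / \<gamma>)\<^sup>2
      + (\<gamma>D - (real p)\<^sup>2 - 1 / \<gamma>) * c\<^sup>2"
    using assms(2) by simp
  moreover have "cut_form_zero p \<gamma>D \<gamma> u q =
      integral {-1..0} (\<lambda>x. (poly (pderiv u) x)\<^sup>2) - 2 * (s + e) * c + \<gamma>D * c\<^sup>2
      + \<gamma> * jump_penalty p u q"
    by (simp add: cut_form_zero_def s_def c_def e_def)
  ultimately show ?thesis
    by linarith
qed

text \<open>
  The pair makes every estimate of the nonnegativity proof an equality: \<open>u'\<close> is the kernel, the
  jump of the first derivative is \<open>1/\<gamma>\<close>, and the penalty sees no other jump. The normalisation
  \<open>q(0) = 1\<close> matches \<open>u'(0) = p\<^sup>2\<close>.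
\<close>

lemma cut_form_zero_witness:
  assumes "p \<ge> 1" and "\<gamma> > 0"
  obtains u q where "degree u \<le> p" and "degree q \<le> p"
    and "cut_form_zero p \<gamma>D \<gamma> u q = \<gamma>D - (real p)\<^sup>2 - 1 / \<gamma>"
proof
  define u where "u = kernel_primitive p"
  define q where "q = u + [:1 - poly u 0, 1 / \<gamma>:]"
  show u: "degree u \<le> p"
    by (simp add: u_def degree_kernel_primitive)
  show "degree q \<le> p"
    unfolding q_def using assms(1) u by (intro degree_add_le) auto
  have "jump_penalty p u q = (\<Sum>k=1..p. if k = 1 then (1 / \<gamma>)\<^sup>2 else 0)"
    unfolding jump_penalty_eq_sum_coeff
    by (intro sum.cong) (auto simp: q_def coeff_pCons split: nat.splits)
  then have "jump_penalty p u q = (1 / \<gamma>)\<^sup>2"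
    using assms(1) by simp
  moreover have "poly q 0 = 1" "poly (pderiv q) 0 = (real p)\<^sup>2 + 1 / \<gamma>"
    using kernel_at_0[OF assms(1)] by (simp_all add: q_def u_def pderiv_add pderiv_pCons)
  ultimately show "cut_form_zero p \<gamma>D \<gamma> u q = \<gamma>D - (real p)\<^sup>2 - 1 / \<gamma>"
    using kernel_norm[OF assms(1)] assms(2)
    by (simp add: cut_form_zero_def u_def power2_eq_square field_simps)
qed

lemma cut_form_zero_witness_neg:
  assumes "p \<ge> 1" and "\<gamma> > 0" and "\<gamma> * (\<gamma>D - (real p)\<^sup>2) < 1"
  obtains u q where "u \<in> polys_upto p" and "q \<in> polys_upto p"
    and "cut_form_zero p \<gamma>D \<gamma> u q < 0"
proof -
  have "\<gamma>D - (real p)\<^sup>2 - 1 / \<gamma> < 0"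
    using assms(2,3) by (simp add: field_simps)
  moreover obtain u q where "degree u \<le> p" "degree q \<le> p"
    and "cut_form_zero p \<gamma>D \<gamma> u q = \<gamma>D - (real p)\<^sup>2 - 1 / \<gamma>"
    using cut_form_zero_witness[OF assms(1,2)] .
  ultimately show thesis
    by (intro that[of u q]) (simp_all add: polys_upto_def)
qed

section \<open>Small cut cells\<close>

text \<open>
  On the pair \<open>(1, 1)\<close> all derivatives and jumps vanish, so both forms take the value \<open>\<gamma>D\<close> there.
\<close>

lemma cut_form_indefiniteI:
  assumes "\<gamma>D > 0" and "u \<in> polys_upto p" and "q \<in> polys_upto p"
  shows "cut_form p \<gamma>D \<kappa> \<gamma> u q < 0 \<Longrightarrow> form_indefinite p (cut_form p \<gamma>D \<kappa> \<gamma>)"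
    and "cut_form_zero p \<gamma>D \<gamma> u q < 0 \<Longrightarrow> form_indefinite p (cut_form_zero p \<gamma>D \<gamma>)"
proof -
  have "1 \<in> polys_upto p" "cut_form p \<gamma>D \<kappa> \<gamma> 1 1 > 0" "cut_form_zero p \<gamma>D \<gamma> 1 1 > 0"
    using assms(1)
    by (simp_all add: polys_upto_def cut_form_def cut_form_zero_def jump_penalty_eq_sum_coeff)
  then show "cut_form p \<gamma>D \<kappa> \<gamma> u q < 0 \<Longrightarrow> form_indefinite p (cut_form p \<gamma>D \<kappa> \<gamma>)"
    and "cut_form_zero p \<gamma>D \<gamma> u q < 0 \<Longrightarrow> form_indefinite p (cut_form_zero p \<gamma>D \<gamma>)"
    unfolding form_indefinite_def using assms(2,3) by blast+
qed

lemma form_indefinite_imp_not_psd: "form_indefinite p a \<Longrightarrow> \<not> form_psd p a"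
  unfolding form_indefinite_def form_psd_def by force

lemma cut_form_tendsto_cut_form_zero:
  "((\<lambda>\<kappa>. cut_form p \<gamma>D \<kappa> \<gamma> u q) \<longlongrightarrow> cut_form_zero p \<gamma>D \<gamma> u q) (at_right 0)"
proof -
  let ?F = "\<lambda>\<kappa>. integral {0..\<kappa>} (\<lambda>x. (poly (pderiv q) x)\<^sup>2)"
  have "continuous_on {0..1} ?F"
    by (intro indefinite_integral_continuous_1 integrable_continuous_real continuous_intros)
  then have "(?F \<longlongrightarrow> ?F 0) (at 0 within {0..1})"
    unfolding continuous_on by (rule bspec) simp
  then have "(?F \<longlongrightarrow> 0) (at_right 0)"
    by (simp add: at_within_Icc_at_right)
  then have "((\<lambda>\<kappa>. cut_form p \<gamma>D \<kappa> \<gamma> u q) \<longlongrightarrow>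
      integral {-1..0} (\<lambda>x. (poly (pderiv u) x)\<^sup>2) + 0 - 2 * poly (pderiv q) 0 * poly q 0
      + \<gamma>D * (poly q 0)\<^sup>2 + \<gamma> * jump_penalty p u q) (at_right 0)"
    unfolding cut_form_def by (intro tendsto_intros)
  then show ?thesis
    by (simp add: cut_form_zero_def)
qed

lemma cut_form_indefinite_for_small_cells:
  assumes "p \<ge> 1" and "\<gamma>D > 0" and "\<gamma> > 0" and "\<gamma> * (\<gamma>D - (real p)\<^sup>2) < 1"
  shows "\<exists>\<kappa>0>0. \<forall>\<kappa>\<in>{0<..<\<kappa>0}. form_indefinite p (cut_form p \<gamma>D \<kappa> \<gamma>)"
proof -
  obtain u q where uq: "u \<in> polys_upto p" "q \<in> polys_upto p"
    and neg: "cut_form_zero p \<gamma>D \<gamma> u q < 0"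
    using cut_form_zero_witness_neg[OF assms(1,3,4)] .
  have "\<forall>\<^sub>F \<kappa> in at_right 0. cut_form p \<gamma>D \<kappa> \<gamma> u q < 0"
    using order_tendstoD(2)[OF cut_form_tendsto_cut_form_zero neg] .
  then obtain \<kappa>0 where "\<kappa>0 > 0" "\<And>\<kappa>. 0 < \<kappa> \<Longrightarrow> \<kappa> < \<kappa>0 \<Longrightarrow> cut_form p \<gamma>D \<kappa> \<gamma> u q < 0"
    unfolding eventually_at_right_field by auto
  then show ?thesis
    using cut_form_indefiniteI(1)[OF assms(2) uq] by auto
qed

text \<open>The penalty is nonnegative, so semidefiniteness is inherited by larger \<open>\<gamma>\<close>.\<close>

lemma gamma_star_ge:
  assumes "\<not> form_psd p (cut_form p \<gamma>D \<kappa> \<gamma>)"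
  shows "ereal \<gamma> \<le> gamma_star p \<gamma>D \<kappa>"
  unfolding gamma_star_def
proof (rule INF_greatest)
  fix \<gamma>'
  assume "\<gamma>' \<in> {\<gamma>. \<gamma> > 0 \<and> form_psd p (cut_form p \<gamma>D \<kappa> \<gamma>)}"
  then have psd: "form_psd p (cut_form p \<gamma>D \<kappa> \<gamma>')"
    by simp
  obtain u q where uq: "u \<in> polys_upto p" "q \<in> polys_upto p" "cut_form p \<gamma>D \<kappa> \<gamma> u q < 0"
    using assms unfolding form_psd_def by (meson not_le)
  then have "cut_form p \<gamma>D \<kappa> \<gamma> u q < cut_form p \<gamma>D \<kappa> \<gamma>' u q"
    using psd unfolding form_psd_def by (meson less_le_trans)
  then have "\<gamma> * jump_penalty p u q < \<gamma>' * jump_penalty p u q"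
    by (simp add: cut_form_def)
  then have "\<gamma> < \<gamma>'"
    using jump_penalty_nonneg by (rule mult_right_less_imp_less)
  then show "ereal \<gamma> \<le> ereal \<gamma>'"
    by simp
qed

lemma SUP_gamma_star_ge:
  assumes "p \<ge> 1" and "\<gamma>D > 0" and "\<gamma> > 0" and "\<gamma> * (\<gamma>D - (real p)\<^sup>2) < 1"
  shows "ereal \<gamma> \<le> (SUP \<kappa>\<in>{0<..<1}. gamma_star p \<gamma>D \<kappa>)"
proof -
  obtain \<kappa>0 where "\<kappa>0 > 0" and indef: "\<forall>\<kappa>\<in>{0<..<\<kappa>0}. form_indefinite p (cut_form p \<gamma>D \<kappa> \<gamma>)"
    using cut_form_indefinite_for_small_cells[OF assms] by blast
  define \<kappa> where "\<kappa> = min \<kappa>0 1 / 2"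
  have \<kappa>: "\<kappa> \<in> {0<..<\<kappa>0}" "\<kappa> \<in> {0<..<1}"
    using \<open>\<kappa>0 > 0\<close> by (auto simp: \<kappa>_def min_def)
  then have "ereal \<gamma> \<le> gamma_star p \<gamma>D \<kappa>"
    using indef form_indefinite_imp_not_psd gamma_star_ge by blast
  then show ?thesis
    using \<kappa>(2) by (rule SUP_upper2[rotated])
qed

section \<open>The sharp penalty threshold\<close>

theorem proposition5:
  fixes p :: nat and \<gamma>D :: real
  assumes "p \<ge> 1" and "\<gamma>D > 0"
  shows
    "(\<gamma>D > (real p)\<^sup>2 \<longrightarrow>
        (\<forall>\<gamma>>0. form_psd p (cut_form_zero p \<gamma>D \<gamma>) \<longleftrightarrow> \<gamma> \<ge> 1 / (\<gamma>D - (real p)\<^sup>2)))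
   \<and> (\<gamma>D \<le> (real p)\<^sup>2 \<longrightarrow>
        (\<forall>\<gamma>>0. form_indefinite p (cut_form_zero p \<gamma>D \<gamma>)))
   \<and> (\<forall>\<gamma>>0. \<gamma> * (\<gamma>D - (real p)\<^sup>2) < 1 \<longrightarrow>
        (\<exists>\<kappa>0>0. \<forall>\<kappa>\<in>{0<..<\<kappa>0}. form_indefinite p (cut_form p \<gamma>D \<kappa> \<gamma>)))
   \<and> (\<gamma>D > (real p)\<^sup>2 \<longrightarrow>
        (SUP \<kappa>\<in>{0<..<1}. gamma_star p \<gamma>D \<kappa>) \<ge> ereal (1 / (\<gamma>D - (real p)\<^sup>2)))
   \<and> (\<gamma>D \<le> (real p)\<^sup>2 \<longrightarrow>
        (SUP \<kappa>\<in>{0<..<1}. gamma_star p \<gamma>D \<kappa>) = \<infinity>)"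
proof (intro conjI impI allI)
  have indefinite: "form_indefinite p (cut_form_zero p \<gamma>D \<gamma>)"
    if "\<gamma> > 0" "\<gamma> * (\<gamma>D - (real p)\<^sup>2) < 1" for \<gamma>
    using cut_form_zero_witness_neg[OF assms(1) that] cut_form_indefiniteI(2)[OF assms(2)] by metis
  show "form_psd p (cut_form_zero p \<gamma>D \<gamma>) \<longleftrightarrow> \<gamma> \<ge> 1 / (\<gamma>D - (real p)\<^sup>2)"
    if "\<gamma>D > (real p)\<^sup>2" "\<gamma> > 0" for \<gamma>
  proof -
    have "\<gamma> \<ge> 1 / (\<gamma>D - (real p)\<^sup>2) \<longleftrightarrow> \<gamma> * (\<gamma>D - (real p)\<^sup>2) \<ge> 1"
      using that(1) by (simp add: pos_divide_le_eq)
    moreover have "form_psd p (cut_form_zero p \<gamma>D \<gamma>)" if "\<gamma> * (\<gamma>D - (real p)\<^sup>2) \<ge> 1"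
      using cut_form_zero_nonneg[OF assms(1) \<open>\<gamma> > 0\<close> that]
      by (auto simp: form_psd_def polys_upto_def)
    ultimately show ?thesis
      using indefinite[OF that(2)] form_indefinite_imp_not_psd not_le by blast
  qed
  have subcritical: "\<gamma> * (\<gamma>D - (real p)\<^sup>2) < 1" if "\<gamma>D \<le> (real p)\<^sup>2" "\<gamma> > 0" for \<gamma>
    using mult_nonneg_nonpos[of \<gamma> "\<gamma>D - (real p)\<^sup>2"] that by simp
  then show "form_indefinite p (cut_form_zero p \<gamma>D \<gamma>)" if "\<gamma>D \<le> (real p)\<^sup>2" "\<gamma> > 0" for \<gamma>
    using indefinite that by blast
  show "\<exists>\<kappa>0>0. \<forall>\<kappa>\<in>{0<..<\<kappa>0}. form_indefinite p (cut_form p \<gamma>D \<kappa> \<gamma>)"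
    if "\<gamma> > 0" "\<gamma> * (\<gamma>D - (real p)\<^sup>2) < 1" for \<gamma>
    using cut_form_indefinite_for_small_cells[OF assms that] .
  let ?S = "SUP \<kappa>\<in>{0<..<1}. gamma_star p \<gamma>D \<kappa>"
  show "?S \<ge> ereal (1 / (\<gamma>D - (real p)\<^sup>2))" if "\<gamma>D > (real p)\<^sup>2"
  proof (rule dense_le)
    fix x :: ereal
    assume x: "x < ereal (1 / (\<gamma>D - (real p)\<^sup>2))"
    \<comment> \<open>The maximum keeps the penalty parameter positive when \<open>x\<close> is negative or \<open>-\<infinity>\<close>.\<close>
    have "x \<le> ereal (max (real_of_ereal x) (1 / (2 * (\<gamma>D - (real p)\<^sup>2))))" (is "_ \<le> ereal ?\<gamma>")
      using x by (cases x) auto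
    also have "ereal ?\<gamma> \<le> ?S"
    proof (rule SUP_gamma_star_ge[OF assms])
      show "?\<gamma> > 0"
        using that by (simp add: less_max_iff_disj)
      have "?\<gamma> < 1 / (\<gamma>D - (real p)\<^sup>2)"
        using x that by (cases x) (auto simp: field_simps)
      then show "?\<gamma> * (\<gamma>D - (real p)\<^sup>2) < 1"
        using that pos_less_divide_eq[of "\<gamma>D - (real p)\<^sup>2" ?\<gamma> 1]
        by (metis diff_gt_0_iff_gt)
    qed
    finally show "x \<le> ?S" .
  qed
  show "?S = \<infinity>" if "\<gamma>D \<le> (real p)\<^sup>2"
  proof (rule ereal_top)
    fix B :: real
    have "ereal B \<le> ereal (max B 1)"
      by simp
    also have "\<dots> \<le> ?S"
      using subcritical[OF that] by (intro SUP_gamma_star_ge[OF assms]) auto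
    finally show "ereal B \<le> ?S" .
  qed
qed

end
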